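(* Let $\alpha,\beta,\alpha_1,\beta_1\in\mathbb{C}$ all be nonzero with $|\alpha|^2+|\beta|^2=1$, $|\alpha_1|^2+|\beta_1|^2=1$ and $(\alpha,\beta)\neq(\alpha_1,\beta_1)$. Then $S_{\alpha,\beta}$ on $H^2_{\alpha,\beta}$ and $S_{\alpha_1,\beta_1}$ on $H^2_{\alpha_1,\beta_1}$ are unitarily equivalent if and only if $$|\alpha|=|\alpha_1|,\qquad |\beta|=|\beta_1|\qquad\text{and}\qquad \frac{\alpha}{\alpha_1}=\frac{\overline{\beta_1}}{\overline{\beta}}.$$
   Context: $H^2(\mathbb{D})$ is the Hardy space of the open unit disc. For nonzero $\alpha,\beta\in\mathbb{C}$ with $|\alpha|^2+|\beta|^2=1$, let $H^2_{\alpha,\beta}=\overline{\mathrm{span}}\{\alpha+\beta z,\ z^n: n\ge 2\}$, a closed subspace of $H^2(\mathbb{D})$. Let $P_{H^2_{\alpha,\beta}}$ be the orthogonal projection of $H^2(\mathbb{D})$ onto $H^2_{\alpha,\beta}$, $M_z$ multiplication by $z$ on $H^2(\mathbb{D})$, and $S_{\alpha,\beta}=P_{H^2_{\alpha,\beta}}M_z|_{H^2_{\alpha,\beta}}$. *)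

theory Defs
  imports "HOL-Complex_Analysis.Complex_Analysis"
begin

definition taylor_coeff :: "(complex \<Rightarrow> complex) \<Rightarrow> nat \<Rightarrow> complex"
  where "taylor_coeff f n = fps_nth (fps_expansion f 0) n"

text \<open>
  Membership is square summability of the Taylor coefficients at 0, which for a holomorphic
  function on the disc is equivalent to boundedness of the quadratic integral means.
  A function on the disc is represented by a total function that vanishes off the disc, so that
  equality of elements is equality of functions on the disc.
\<close>

definition hardy2_funs :: "(complex \<Rightarrow> complex) set"
  where "hardy2_funs = {f. f holomorphic_on ball 0 1 \<and> (\<forall>z. z \<notin> ball 0 1 \<longrightarrow> f z = 0) \<and>
                           summable (\<lambda>n. (cmod (taylor_coeff f n))\<^sup>2)}"

lemma taylor_coeff_has_fps_expansion:
  "f has_fps_expansion F \<Longrightarrow> taylor_coeff f n = fps_nth F n"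
  by (simp add: taylor_coeff_def fps_expansion_eqI)

lemma holomorphic_has_fps_expansion:
  "f holomorphic_on ball 0 1 \<Longrightarrow> f has_fps_expansion fps_expansion f 0"
  by (rule has_fps_expansion_fps_expansion[of "ball 0 1"]) auto

lemma taylor_coeff_0: "taylor_coeff (\<lambda>z. 0) n = 0"
  by (subst taylor_coeff_has_fps_expansion[OF has_fps_expansion_0]) simp

lemma taylor_coeff_add:
  assumes "f holomorphic_on ball 0 1" "g holomorphic_on ball 0 1"
  shows "taylor_coeff (\<lambda>z. f z + g z) n = taylor_coeff f n + taylor_coeff g n"
  using taylor_coeff_has_fps_expansion[OF has_fps_expansion_add[OF assms[THEN holomorphic_has_fps_expansion]]]
  by (simp add: taylor_coeff_def)

lemma taylor_coeff_cmult:
  assumes "f holomorphic_on ball 0 1"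
  shows "taylor_coeff (\<lambda>z. c * f z) n = c * taylor_coeff f n"
  using taylor_coeff_has_fps_expansion[OF has_fps_expansion_cmult_left[OF assms[THEN holomorphic_has_fps_expansion]]]
  by (simp add: taylor_coeff_def)

lemma taylor_coeff_times_z:
  assumes "f holomorphic_on ball 0 1"
  shows "taylor_coeff (\<lambda>z. z * f z) n = (if n = 0 then 0 else taylor_coeff f (n - 1))"
  using taylor_coeff_has_fps_expansion[OF has_fps_expansion_mult[OF has_fps_expansion_fps_X assms[THEN holomorphic_has_fps_expansion]]]
  by (simp add: taylor_coeff_def)

lemma cmod_add_power2_le: "(cmod (a + b))\<^sup>2 \<le> 2 * (cmod a)\<^sup>2 + 2 * (cmod b)\<^sup>2"
proof -
  have "(cmod (a + b))\<^sup>2 \<le> (cmod a + cmod b)\<^sup>2"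
    by (intro power_mono norm_triangle_ineq) auto
  also have "\<dots> \<le> 2 * (cmod a)\<^sup>2 + 2 * (cmod b)\<^sup>2"
    using sum_squares_bound[of "cmod a" "cmod b"] by (simp add: power2_sum)
  finally show ?thesis .
qed

lemma hardy2_funs_0: "(\<lambda>z. 0) \<in> hardy2_funs"
  by (simp add: hardy2_funs_def taylor_coeff_0)

lemma hardy2_funs_add:
  assumes "f \<in> hardy2_funs" "g \<in> hardy2_funs"
  shows "(\<lambda>z. f z + g z) \<in> hardy2_funs"
proof -
  have "summable (\<lambda>n. 2 * (cmod (taylor_coeff f n))\<^sup>2 + 2 * (cmod (taylor_coeff g n))\<^sup>2)"
    using assms by (intro summable_add summable_mult) (auto simp: hardy2_funs_def)
  hence "summable (\<lambda>n. (cmod (taylor_coeff f n + taylor_coeff g n))\<^sup>2)"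
    by (rule summable_comparison_test'[where N = 0]) (auto intro: cmod_add_power2_le)
  thus ?thesis
    using assms by (auto simp: hardy2_funs_def taylor_coeff_add intro!: holomorphic_intros)
qed

lemma hardy2_funs_cmult:
  assumes "f \<in> hardy2_funs"
  shows "(\<lambda>z. c * f z) \<in> hardy2_funs"
  using assms
  by (auto simp: hardy2_funs_def taylor_coeff_cmult norm_mult power_mult_distrib
           intro!: holomorphic_intros summable_mult)

lemma hardy2_funs_times_z:
  assumes "f \<in> hardy2_funs"
  shows "(\<lambda>z. z * f z) \<in> hardy2_funs"
proof -
  have "summable (\<lambda>n. (cmod (taylor_coeff (\<lambda>z. z * f z) (Suc n)))\<^sup>2)"
    using assms by (simp add: hardy2_funs_def taylor_coeff_times_z)
  hence "summable (\<lambda>n. (cmod (taylor_coeff (\<lambda>z. z * f z) n))\<^sup>2)"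
    by (subst (asm) summable_Suc_iff)
  thus ?thesis
    using assms by (auto simp: hardy2_funs_def intro!: holomorphic_intros)
qed

lemma hardy2_funs_one: "(\<lambda>z. if z \<in> ball 0 1 then 1 else 0) \<in> hardy2_funs"
proof -
  let ?f = "\<lambda>z::complex. if z \<in> ball 0 1 then 1 else 0 :: complex"
  have "eventually (\<lambda>z. z \<in> ball 0 1) (nhds (0::complex))"
    by (intro eventually_nhds_in_open) auto
  hence "eventually (\<lambda>z. ?f z = 1) (nhds 0)"
    by eventually_elim simp
  hence "?f has_fps_expansion 1"
    using has_fps_expansion_1 by (subst has_fps_expansion_cong) auto
  hence *: "taylor_coeff ?f n = (if n = 0 then 1 else 0)" for n
    by (subst taylor_coeff_has_fps_expansion) auto
  have "summable (\<lambda>n. (cmod (taylor_coeff ?f n))\<^sup>2)"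
    unfolding * by (rule summable_finite[of "{0}"]) auto
  moreover have "?f holomorphic_on ball 0 1"
    using holomorphic_on_const[of 1 "ball 0 1"] by (rule holomorphic_transform) auto
  ultimately show ?thesis
    by (auto simp: hardy2_funs_def)
qed

lemma hardy2_funs_eqI:
  assumes "f \<in> hardy2_funs" "\<And>n. taylor_coeff f n = 0"
  shows "f = (\<lambda>z. 0)"
proof
  fix z
  have "fps_expansion f 0 = 0"
    using assms(2) by (auto simp: taylor_coeff_def fps_eq_iff)
  hence "f has_fps_expansion 0"
    using assms holomorphic_has_fps_expansion[of f] by (simp add: hardy2_funs_def)
  hence "z \<in> ball 0 1 \<Longrightarrow> f z = 0"
    using assms by (intro has_fps_expansion_0_analytic_continuation[of f "ball 0 1"])
      (auto simp: hardy2_funs_def)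
  thus "f z = 0"
    using assms by (auto simp: hardy2_funs_def)
qed

typedef hardy2 = hardy2_funs
  morphisms hardy_fun Abs_hardy2
  using hardy2_funs_0 by blast

setup_lifting type_definition_hardy2

definition hcoeff :: "hardy2 \<Rightarrow> nat \<Rightarrow> complex"
  where "hcoeff f = taylor_coeff (hardy_fun f)"

lift_definition hscale :: "complex \<Rightarrow> hardy2 \<Rightarrow> hardy2" is "\<lambda>c f z. c * f z"
  by (rule hardy2_funs_cmult)

lift_definition hone :: hardy2 is "\<lambda>z. if z \<in> ball 0 1 then 1 else 0"
  by (rule hardy2_funs_one)

lift_definition mult_z :: "hardy2 \<Rightarrow> hardy2" is "\<lambda>f z. z * f z"
  by (rule hardy2_funs_times_z)

definition hmonom :: "nat \<Rightarrow> hardy2"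
  where "hmonom n = (mult_z ^^ n) hone"

lemma hardy_fun_hmonom: "hardy_fun (hmonom n) z = (if z \<in> ball 0 1 then z ^ n else 0)"
  by (induction n) (auto simp: hmonom_def hone.rep_eq mult_z.rep_eq)

definition hinner :: "hardy2 \<Rightarrow> hardy2 \<Rightarrow> complex"
  where "hinner f g = (\<Sum>n. hcoeff f n * cnj (hcoeff g n))"

lemma summable_hcoeff: "summable (\<lambda>n. (cmod (hcoeff f n))\<^sup>2)"
  using hardy_fun[of f] by (auto simp: hcoeff_def hardy2_funs_def)

lemma hardy_fun_holomorphic: "hardy_fun f holomorphic_on ball 0 1"
  using hardy_fun[of f] by (auto simp: hardy2_funs_def)

lemma summable_hinner: "summable (\<lambda>n. hcoeff f n * cnj (hcoeff g n))"
proof (rule summable_comparison_test'[where N = 0])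
  show "summable (\<lambda>n. (cmod (hcoeff f n))\<^sup>2 + (cmod (hcoeff g n))\<^sup>2)"
    by (intro summable_add summable_hcoeff)
next
  fix n
  have "2 * (cmod (hcoeff f n) * cmod (hcoeff g n)) \<le> (cmod (hcoeff f n))\<^sup>2 + (cmod (hcoeff g n))\<^sup>2"
    using sum_squares_bound[of "cmod (hcoeff f n)" "cmod (hcoeff g n)"] by simp
  moreover have "0 \<le> cmod (hcoeff f n) * cmod (hcoeff g n)"
    by simp
  ultimately show "cmod (hcoeff f n * cnj (hcoeff g n)) \<le> (cmod (hcoeff f n))\<^sup>2 + (cmod (hcoeff g n))\<^sup>2"
    unfolding norm_mult complex_mod_cnj by linarith
qed

instantiation hardy2 :: real_vector
begin

lift_definition zero_hardy2 :: hardy2 is "\<lambda>z. 0"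
  by (rule hardy2_funs_0)

lift_definition plus_hardy2 :: "hardy2 \<Rightarrow> hardy2 \<Rightarrow> hardy2" is "\<lambda>f g z. f z + g z"
  by (rule hardy2_funs_add)

definition uminus_hardy2 :: "hardy2 \<Rightarrow> hardy2"
  where "uminus_hardy2 f = hscale (- 1) f"

definition minus_hardy2 :: "hardy2 \<Rightarrow> hardy2 \<Rightarrow> hardy2"
  where "minus_hardy2 f g = f + hscale (- 1) g"

definition scaleR_hardy2 :: "real \<Rightarrow> hardy2 \<Rightarrow> hardy2"
  where "scaleR_hardy2 r f = hscale (of_real r) f"

instance
  by (standard; (unfold uminus_hardy2_def minus_hardy2_def scaleR_hardy2_def)?; transfer;
      simp add: algebra_simps)

end

interpretation hardy: vector_space hscale
  by standard (transfer; simp add: algebra_simps)+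

lemma hcoeff_0: "hcoeff 0 n = 0"
  by (simp add: hcoeff_def zero_hardy2.rep_eq taylor_coeff_0)

lemma hcoeff_add: "hcoeff (f + g) n = hcoeff f n + hcoeff g n"
  by (simp add: hcoeff_def plus_hardy2.rep_eq taylor_coeff_add hardy_fun_holomorphic)

lemma hcoeff_hscale: "hcoeff (hscale c f) n = c * hcoeff f n"
  by (simp add: hcoeff_def hscale.rep_eq taylor_coeff_cmult hardy_fun_holomorphic)

lemma hcoeff_eq_0: "(\<And>n. hcoeff f n = 0) \<Longrightarrow> f = 0"
  using hardy2_funs_eqI[OF hardy_fun[of f]]
  by (simp add: hcoeff_def zero_hardy2.rep_eq hardy_fun_inject[symmetric])

lemma hinner_add_left: "hinner (f + g) h = hinner f h + hinner g h"
  unfolding hinner_def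
  by (subst suminf_add[OF summable_hinner summable_hinner]) (simp add: hcoeff_add algebra_simps)

lemma hinner_hscale_left: "hinner (hscale c f) h = c * hinner f h"
  unfolding hinner_def
  by (subst suminf_mult[OF summable_hinner, symmetric]) (simp add: hcoeff_hscale algebra_simps)

lemma hinner_commute: "hinner f g = cnj (hinner g f)"
proof -
  have "(\<lambda>n. cnj (hcoeff g n * cnj (hcoeff f n))) sums cnj (hinner g f)"
    unfolding hinner_def by (subst sums_cnj) (rule summable_sums[OF summable_hinner])
  thus ?thesis
    unfolding hinner_def[of f g] by (auto simp: sums_iff mult.commute)
qed

lemma hinner_self: "hinner f f = complex_of_real (\<Sum>n. (cmod (hcoeff f n))\<^sup>2)"
  unfolding hinner_def
  by (subst suminf_of_real[OF summable_hcoeff]) (simp only: complex_norm_square)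

text \<open>
  The complex inner product is \<open>hinner\<close>; its real part makes \<open>hardy2\<close> a real inner product space
  with the same norm, which supplies the library's norm, metric and topology.
\<close>

instantiation hardy2 :: real_inner
begin

definition inner_hardy2 :: "hardy2 \<Rightarrow> hardy2 \<Rightarrow> real"
  where "inner_hardy2 f g = Re (hinner f g)"

definition norm_hardy2 :: "hardy2 \<Rightarrow> real"
  where "norm_hardy2 f = sqrt (Re (hinner f f))"

definition dist_hardy2 :: "hardy2 \<Rightarrow> hardy2 \<Rightarrow> real"
  where "dist_hardy2 f g = norm (f - g)"

definition sgn_hardy2 :: "hardy2 \<Rightarrow> hardy2"
  where "sgn_hardy2 f = f /\<^sub>R norm f"

definition uniformity_hardy2 :: "(hardy2 \<times> hardy2) filter"
  where "uniformity_hardy2 = (INF e\<in>{0 <..}. principal {(x, y). dist x y < e})"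

definition open_hardy2 :: "hardy2 set \<Rightarrow> bool"
  where "open_hardy2 S \<longleftrightarrow> (\<forall>x\<in>S. eventually (\<lambda>(x', y). x' = x \<longrightarrow> y \<in> S) uniformity)"

instance
proof
  fix f g h :: hardy2 and r :: real
  show "dist f g = norm (f - g)"
    by (rule dist_hardy2_def)
  show "sgn f = f /\<^sub>R norm f"
    by (rule sgn_hardy2_def)
  show "(uniformity :: (hardy2 \<times> hardy2) filter) = (INF e\<in>{0 <..}. principal {(x, y). dist x y < e})"
    by (rule uniformity_hardy2_def)
  show "open S \<longleftrightarrow> (\<forall>x\<in>S. eventually (\<lambda>(x', y). x' = x \<longrightarrow> y \<in> S) uniformity)" for S :: "hardy2 set"
    by (rule open_hardy2_def)
  show "inner f g = inner g f"
    unfolding inner_hardy2_def by (subst hinner_commute) simp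
  show "inner (f + g) h = inner f h + inner g h"
    by (simp add: inner_hardy2_def hinner_add_left)
  show "inner (r *\<^sub>R f) g = r * inner f g"
    by (simp add: inner_hardy2_def scaleR_hardy2_def hinner_hscale_left)
  show "0 \<le> inner f f"
    by (simp add: inner_hardy2_def hinner_self suminf_nonneg[OF summable_hcoeff])
  show "inner f f = 0 \<longleftrightarrow> f = 0"
  proof
    assume "inner f f = 0"
    hence "(\<Sum>n. (cmod (hcoeff f n))\<^sup>2) = 0"
      by (simp add: inner_hardy2_def hinner_self)
    hence "hcoeff f n = 0" for n
      by (subst (asm) suminf_eq_zero_iff[OF summable_hcoeff]) auto
    thus "f = 0"
      by (rule hcoeff_eq_0)
  qed (simp add: inner_hardy2_def hinner_def hcoeff_0)
  show "norm f = sqrt (inner f f)"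
    by (simp add: norm_hardy2_def inner_hardy2_def)
qed

end

text \<open>Meaningful for a closed subspace \<open>M\<close>, where the orthogonal decomposition exists.\<close>

definition orth_proj :: "hardy2 set \<Rightarrow> hardy2 \<Rightarrow> hardy2"
  where "orth_proj M f = (THE g. g \<in> M \<and> (\<forall>h\<in>M. hinner (f - g) h = 0))"

definition unitary_between :: "hardy2 set \<Rightarrow> hardy2 set \<Rightarrow> (hardy2 \<Rightarrow> hardy2) \<Rightarrow> bool"
  where "unitary_between M N U \<longleftrightarrow>
    bij_betw U M N \<and>
    (\<forall>f\<in>M. \<forall>g\<in>M. U (f + g) = U f + U g) \<and>
    (\<forall>c. \<forall>f\<in>M. U (hscale c f) = hscale c (U f)) \<and>
    (\<forall>f\<in>M. \<forall>g\<in>M. hinner (U f) (U g) = hinner f g)"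

text \<open>\<open>S\<close> is an operator on \<open>M\<close> and \<open>T\<close> an operator on \<open>N\<close>; their values elsewhere play no role.\<close>

definition unitarily_equivalent_on ::
  "hardy2 set \<Rightarrow> (hardy2 \<Rightarrow> hardy2) \<Rightarrow> hardy2 set \<Rightarrow> (hardy2 \<Rightarrow> hardy2) \<Rightarrow> bool"
  where "unitarily_equivalent_on M S N T \<longleftrightarrow>
    (\<exists>U. unitary_between M N U \<and> (\<forall>f\<in>M. U (S f) = T (U f)))"

definition H2ab :: "complex \<Rightarrow> complex \<Rightarrow> hardy2 set"
  where "H2ab \<alpha> \<beta> =
    closure (hardy.span (insert (hscale \<alpha> (hmonom 0) + hscale \<beta> (hmonom 1)) (hmonom ` {2..})))"

definition Sab :: "complex \<Rightarrow> complex \<Rightarrow> hardy2 \<Rightarrow> hardy2"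
  where "Sab \<alpha> \<beta> f = orth_proj (H2ab \<alpha> \<beta>) (mult_z f)"

end

theory Submission
  imports Defs
begin

text \<open>
  Write \<open>e = \<alpha> + \<beta> z\<close> and \<open>k = cnj \<beta> - cnj \<alpha> z\<close>, an orthonormal basis of the polynomials of degree
  at most one. The space \<open>H2ab \<alpha> \<beta>\<close> is the orthogonal complement of the line through \<open>k\<close>, that is,
  one linear equation on the first two Taylor coefficients (\<open>H2ab_eq\<close>). Compressing the shift
  therefore means subtracting from \<open>z f\<close> its component along \<open>k\<close>, which is
  \<open>- \<alpha> f(0) k\<close> (\<open>Sab_formula\<close>).

  Since \<open>M\<^sub>z\<close> is an isometry, the compression shortens \<open>f\<close> exactly by the component that is cut off,
  and on the space \<open>f(0) = \<alpha> \<langle>f, e\<rangle>\<close>. Hence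
  \<open>\<parallel>f\<parallel>\<^sup>2 - \<parallel>S f\<parallel>\<^sup>2 = |\<alpha>|\<^sup>4 |\<langle>f, e\<rangle>|\<^sup>2\<close> (\<open>Sab_defect\<close>): the defect operator \<open>1 - S* S\<close> has rank one,
  with eigenvalue \<open>|\<alpha>|\<^sup>4\<close> and eigenvector \<open>e\<close>. A unitary equivalence preserves the defect, so it
  preserves \<open>|\<alpha>|\<close> and sends \<open>e\<close> to a unimodular multiple of its counterpart; consequently it
  also preserves the matrix entry \<open>\<langle>S e, e\<rangle> = \<alpha> cnj \<beta>\<close>
  (\<open>unitary_equivalence_preserves_parameters\<close>). These are the stated conditions, once
  \<open>\<alpha> / \<alpha>\<^sub>1 = cnj \<beta>\<^sub>1 / cnj \<beta>\<close> is read as \<open>\<alpha> cnj \<beta> = \<alpha>\<^sub>1 cnj \<beta>\<^sub>1\<close>.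

  Conversely, the conditions force \<open>(\<alpha>\<^sub>1, \<beta>\<^sub>1) = (w \<alpha>, w \<beta>)\<close> with \<open>|w| = 1\<close>. Then the generators
  \<open>\<alpha> + \<beta> z\<close> and \<open>\<alpha>\<^sub>1 + \<beta>\<^sub>1 z\<close> span the same line, so the two spaces, and with them the two
  compressions, are equal, and the identity is a unitary equivalence.
\<close>

section \<open>The inner product and Taylor coefficients\<close>

lemma hinner_add_right: "hinner h (f + g) = hinner h f + hinner h g"
  by (metis hinner_commute hinner_add_left complex_cnj_add)

lemma hinner_hscale_right: "hinner f (hscale c g) = cnj c * hinner f g"
  by (metis hinner_commute hinner_hscale_left complex_cnj_mult)

lemma diff_eq_add_hscale: "f - g = f + hscale (-1) g"
  by (rule minus_hardy2_def)

lemma hinner_diff_left: "hinner (f - g) h = hinner f h - hinner g h"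
  unfolding diff_eq_add_hscale hinner_add_left hinner_hscale_left by simp

lemma hinner_self_norm: "hinner f f = complex_of_real ((norm f)\<^sup>2)"
  by (simp add: norm_hardy2_def hinner_self suminf_nonneg[OF summable_hcoeff])

lemma norm_power2_hcoeff: "(norm f)\<^sup>2 = (\<Sum>n. (cmod (hcoeff f n))\<^sup>2)"
  using hinner_self[of f] unfolding hinner_self_norm of_real_eq_iff .

lemma hcoeff_diff: "hcoeff (f - g) n = hcoeff f n - hcoeff g n"
  unfolding diff_eq_add_hscale hcoeff_add hcoeff_hscale by simp

lemma hardy2_eqI:
  assumes "\<And>n. hcoeff f n = hcoeff g n"
  shows "f = g"
  using hcoeff_eq_0[of "f - g"] assms by (simp add: hcoeff_diff)

lemma hcoeff_sum: "hcoeff (\<Sum>i\<in>A. f i) n = (\<Sum>i\<in>A. hcoeff (f i) n)"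
  by (induction A rule: infinite_finite_induct) (simp_all add: hcoeff_0 hcoeff_add)

lemma hcoeff_mult_z: "hcoeff (mult_z f) n = (if n = 0 then 0 else hcoeff f (n - 1))"
  by (simp add: hcoeff_def mult_z.rep_eq taylor_coeff_times_z hardy_fun_holomorphic)

lemma hcoeff_hone: "hcoeff hone n = (if n = 0 then 1 else 0)"
proof -
  have "eventually (\<lambda>z. z \<in> ball 0 1) (nhds (0::complex))"
    by (intro eventually_nhds_in_open) auto
  hence "eventually (\<lambda>z. hardy_fun hone z = 1) (nhds 0)"
    by eventually_elim (simp add: hone.rep_eq)
  hence "hardy_fun hone has_fps_expansion 1"
    using has_fps_expansion_1 by (subst has_fps_expansion_cong) auto
  thus ?thesis
    by (simp add: hcoeff_def taylor_coeff_has_fps_expansion)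
qed

lemma hcoeff_hmonom: "hcoeff (hmonom m) n = (if n = m then 1 else 0)"
  by (induction m arbitrary: n) (auto simp: hmonom_def hcoeff_hone hcoeff_mult_z)

lemma hinner_hmonom: "hinner f (hmonom n) = hcoeff f n"
proof -
  have "hinner f (hmonom n) = (\<Sum>k\<in>{n}. hcoeff f k * cnj (hcoeff (hmonom n) k))"
    unfolding hinner_def by (rule suminf_finite) (auto simp: hcoeff_hmonom)
  thus ?thesis by (simp add: hcoeff_hmonom)
qed

lemma hinner_mult_z: "hinner (mult_z f) (mult_z g) = hinner f g"
  unfolding hinner_def
  using suminf_split_head[OF summable_hinner, of "mult_z f" "mult_z g"]
  by (simp add: hcoeff_mult_z)

text \<open>
  Pythagoras: the remainder \<open>f - \<langle>f, e\<rangle> e\<close> is orthogonal to the unit vector \<open>e\<close>. This one identity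
  yields Bessel's bound, the equality case of Cauchy--Schwarz, and the norm of the compressed shift.
\<close>

lemma norm_power2_minus_component:
  assumes "hinner e e = 1"
  shows "(norm (f - hscale (hinner f e) e))\<^sup>2 = (norm f)\<^sup>2 - (cmod (hinner f e))\<^sup>2"
proof -
  define c where "c = hinner f e"
  define g where "g = f - hscale c e"
  have "hinner g e = 0"
    unfolding g_def hinner_diff_left hinner_hscale_left assms c_def by simp
  hence "hinner e g = 0"
    by (subst hinner_commute) simp
  hence "hinner g g = hinner f g"
    by (subst g_def, unfold hinner_diff_left hinner_hscale_left) simp
  also have "\<dots> = hinner f f - cnj c * c"
    unfolding g_def diff_eq_add_hscale hinner_add_right hinner_hscale_right c_def by simp
  also have "\<dots> = complex_of_real ((norm f)\<^sup>2 - (cmod c)\<^sup>2)"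
    unfolding hinner_self_norm of_real_diff complex_norm_square[of c] by (simp only: mult.commute)
  finally show ?thesis
    unfolding hinner_self_norm of_real_eq_iff by (simp only: g_def c_def)
qed

lemma bessel_unit_vector:
  assumes "hinner e e = 1"
  shows "cmod (hinner f e) \<le> norm f"
proof -
  have "(cmod (hinner f e))\<^sup>2 \<le> (norm f)\<^sup>2"
    using norm_power2_minus_component[OF assms, of f]
      zero_le_power2[of "norm (f - hscale (hinner f e) e)"] by linarith
  thus ?thesis by (rule power2_le_imp_le) simp
qed

lemma cmod_hcoeff_le_norm: "cmod (hcoeff f n) \<le> norm f"
  using bessel_unit_vector[of "hmonom n" f] by (simp add: hinner_hmonom hcoeff_hmonom)

text \<open>
  Coefficients are bounded functionals, so linear equations between them survive passage to the
  closure of a subspace.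
\<close>

lemma tendsto_hcoeff:
  assumes "X \<longlonglongrightarrow> f"
  shows "(\<lambda>k. hcoeff (X k) n) \<longlonglongrightarrow> hcoeff f n"
proof (rule LIM_zero_cancel, rule Lim_null_comparison)
  show "(\<lambda>k. norm (X k - f)) \<longlonglongrightarrow> 0"
    using assms by (simp add: LIM_zero tendsto_norm_zero)
  show "\<forall>\<^sub>F k in sequentially. norm (hcoeff (X k) n - hcoeff f n) \<le> norm (X k - f)"
    by (simp add: hcoeff_diff[symmetric] cmod_hcoeff_le_norm)
qed

text \<open>
  The squared distance from \<open>f\<close> to its \<open>N\<close>-th Taylor sum is a tail of the convergent series for
  \<open>\<parallel>f\<parallel>\<^sup>2\<close>. This puts every solution of the equation in \<open>H2ab_eq\<close> into the closed span.
\<close>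

lemma Taylor_sums_tendsto: "(\<lambda>N. \<Sum>n<N. hscale (hcoeff f n) (hmonom n)) \<longlonglongrightarrow> f"
proof (rule Lim_transform2[OF tendsto_const])
  let ?s = "\<lambda>N. \<Sum>n<N. hscale (hcoeff f n) (hmonom n)"
  have coeff: "hcoeff (f - ?s N) n = (if n < N then 0 else hcoeff f n)" for N n
    by (simp add: hcoeff_diff hcoeff_sum hcoeff_hscale hcoeff_hmonom if_distrib cong: if_cong)
  have "(norm (f - ?s N))\<^sup>2 = (norm f)\<^sup>2 - (\<Sum>n<N. (cmod (hcoeff f n))\<^sup>2)" for N
  proof -
    have "(norm (f - ?s N))\<^sup>2 = (\<Sum>n. (cmod (hcoeff f (n + N)))\<^sup>2)"
      unfolding norm_power2_hcoeff
      by (subst suminf_split_initial_segment[OF summable_hcoeff, of _ N]) (simp add: coeff)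
    thus ?thesis
      unfolding norm_power2_hcoeff[of f]
      by (subst suminf_split_initial_segment[OF summable_hcoeff, of _ N]) simp
  qed
  moreover have "(\<lambda>N. (norm f)\<^sup>2 - (\<Sum>n<N. (cmod (hcoeff f n))\<^sup>2)) \<longlonglongrightarrow> (norm f)\<^sup>2 - (norm f)\<^sup>2"
    unfolding norm_power2_hcoeff by (intro tendsto_intros summable_LIMSEQ summable_hcoeff)
  ultimately have "(\<lambda>N. (norm (f - ?s N))\<^sup>2) \<longlonglongrightarrow> 0"
    by simp
  hence "(\<lambda>N. sqrt ((norm (f - ?s N))\<^sup>2)) \<longlonglongrightarrow> sqrt 0"
    by (rule tendsto_real_sqrt)
  thus "(\<lambda>N. f - ?s N) \<longlonglongrightarrow> 0"
    by (simp add: tendsto_norm_zero_iff)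
qed

section \<open>The space and its compressed shift\<close>

definition lin_poly :: "complex \<Rightarrow> complex \<Rightarrow> hardy2"
  where "lin_poly \<alpha> \<beta> = hscale \<alpha> (hmonom 0) + hscale \<beta> (hmonom 1)"

lemma hinner_lin_poly: "hinner f (lin_poly \<alpha> \<beta>) = cnj \<alpha> * hcoeff f 0 + cnj \<beta> * hcoeff f 1"
  by (simp add: lin_poly_def hinner_add_right hinner_hscale_right hinner_hmonom)

lemma hcoeff_lin_poly: "hcoeff (lin_poly \<alpha> \<beta>) n = (if n = 0 then \<alpha> else if n = 1 then \<beta> else 0)"
  by (simp add: lin_poly_def hcoeff_add hcoeff_hscale hcoeff_hmonom)

lemma H2ab_lin_poly:
  "H2ab \<alpha> \<beta> = closure (hardy.span (insert (lin_poly \<alpha> \<beta>) (hmonom ` {2..})))"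
  by (simp add: H2ab_def lin_poly_def)

lemma hinner_lin_poly_self:
  assumes "(cmod \<alpha>)\<^sup>2 + (cmod \<beta>)\<^sup>2 = 1"
  shows "hinner (lin_poly \<alpha> \<beta>) (lin_poly \<alpha> \<beta>) = 1"
proof -
  have "hinner (lin_poly \<alpha> \<beta>) (lin_poly \<alpha> \<beta>) = complex_of_real ((cmod \<alpha>)\<^sup>2 + (cmod \<beta>)\<^sup>2)"
    by (simp add: hinner_lin_poly hcoeff_lin_poly complex_norm_square mult.commute del: of_real_power)
  thus ?thesis by (simp add: assms)
qed

text \<open>
  The equation says that \<open>f\<close> is orthogonal to \<open>cnj \<beta> - cnj \<alpha> z\<close>. It holds on the generators and is
  closed, which gives one inclusion. For the other one, the equation makes \<open>f(0) + f'(0) z\<close>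
  a multiple of \<open>\<alpha> + \<beta> z\<close>, so that all Taylor sums of order at least two lie in the span.
\<close>

lemma H2ab_eq:
  assumes "\<alpha> \<noteq> 0"
  shows "H2ab \<alpha> \<beta> = {f. \<beta> * hcoeff f 0 = \<alpha> * hcoeff f 1}"
proof (intro equalityI subsetI)
  let ?G = "insert (lin_poly \<alpha> \<beta>) (hmonom ` {2..})"
  let ?K = "{f. \<beta> * hcoeff f 0 = \<alpha> * hcoeff f 1}"
  {
    fix f assume f: "f \<in> H2ab \<alpha> \<beta>"
    have "hardy.subspace ?K"
      by (rule hardy.subspaceI) (simp_all add: hcoeff_0 hcoeff_add hcoeff_hscale algebra_simps)
    moreover have "?G \<subseteq> ?K"
      by (auto simp: hcoeff_lin_poly hcoeff_hmonom)
    ultimately have "hardy.span ?G \<subseteq> ?K"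
      by (rule hardy.span_minimal[rotated])
    then obtain X where X: "\<And>n. X n \<in> ?K" "X \<longlonglongrightarrow> f"
      using f unfolding H2ab_lin_poly closure_sequential by blast
    have "(\<lambda>n. \<beta> * hcoeff (X n) 0) \<longlonglongrightarrow> \<beta> * hcoeff f 0"
         "(\<lambda>n. \<alpha> * hcoeff (X n) 1) \<longlonglongrightarrow> \<alpha> * hcoeff f 1"
      by (intro tendsto_intros tendsto_hcoeff X)+
    with X(1) show "f \<in> ?K"
      using LIMSEQ_unique by auto
  }
  {
    fix f assume f: "f \<in> ?K"
    let ?s = "\<lambda>N. \<Sum>n<N. hscale (hcoeff f n) (hmonom n)"
    have "?s (2 + N) \<in> hardy.span ?G" for N
    proof (induction N)
      case 0
      have "?s 2 = hscale (hcoeff f 0 / \<alpha>) (lin_poly \<alpha> \<beta>)"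
        using f assms by (intro hardy2_eqI)
          (auto simp: eval_nat_numeral hcoeff_add hcoeff_hscale hcoeff_hmonom hcoeff_lin_poly field_simps)
      thus ?case
        by (simp add: hardy.span_base hardy.span_scale del: One_nat_def)
    next
      case (Suc N)
      have "hscale (hcoeff f (2 + N)) (hmonom (2 + N)) \<in> hardy.span ?G"
        by (intro hardy.span_scale hardy.span_base) auto
      with Suc show ?case
        by (simp add: hardy.span_add)
    qed
    moreover have "(\<lambda>N. ?s (2 + N)) \<longlonglongrightarrow> f"
      using LIMSEQ_ignore_initial_segment[OF Taylor_sums_tendsto, of f 2] by (simp add: add.commute)
    ultimately show "f \<in> H2ab \<alpha> \<beta>"
      unfolding H2ab_lin_poly closure_sequential
      by (intro exI[of _ "\<lambda>N. ?s (2 + N)"]) blast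
  }
qed

lemma lin_poly_in_H2ab: "\<alpha> \<noteq> 0 \<Longrightarrow> lin_poly \<alpha> \<beta> \<in> H2ab \<alpha> \<beta>"
  by (simp add: H2ab_eq hcoeff_lin_poly)

text \<open>
  With \<open>k = cnj \<beta> - cnj \<alpha> z\<close> the right-hand side is \<open>z f - \<langle>z f, k\<rangle> k\<close>, the projection onto the
  orthogonal complement of \<open>k\<close>. Exhibiting it also shows that the description by which
  \<open>orth_proj\<close> selects its value is satisfied here.
\<close>

lemma Sab_formula:
  assumes "\<alpha> \<noteq> 0" "(cmod \<alpha>)\<^sup>2 + (cmod \<beta>)\<^sup>2 = 1"
  shows "Sab \<alpha> \<beta> f = mult_z f + hscale (\<alpha> * hcoeff f 0) (lin_poly (cnj \<beta>) (- cnj \<alpha>))"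
    and "Sab \<alpha> \<beta> f \<in> H2ab \<alpha> \<beta>"
proof -
  let ?k = "lin_poly (cnj \<beta>) (- cnj \<alpha>)"
  let ?g = "mult_z f + hscale (\<alpha> * hcoeff f 0) ?k"
  have unit: "\<alpha> * cnj \<alpha> + \<beta> * cnj \<beta> = 1"
    using assms(2) by (metis complex_norm_square of_real_add of_real_1)
  have "\<beta> * hcoeff ?g 0 - \<alpha> * hcoeff ?g 1 = \<alpha> * hcoeff f 0 * ((\<alpha> * cnj \<alpha> + \<beta> * cnj \<beta>) - 1)"
    by (simp add: hcoeff_add[of "mult_z f"] hcoeff_hscale[of _ ?k] hcoeff_lin_poly hcoeff_mult_z
        algebra_simps del: One_nat_def)
  hence g: "?g \<in> H2ab \<alpha> \<beta>"
    using assms(1) unit by (simp add: H2ab_eq)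
  have ker: "hinner ?k h = 0" if "h \<in> H2ab \<alpha> \<beta>" for h
  proof -
    have "hinner h ?k = 0"
      using that assms(1) by (simp add: H2ab_eq hinner_lin_poly)
    thus ?thesis by (simp add: hinner_commute[of ?k])
  qed
  have orth: "hinner (mult_z f - ?g) h = 0" if "h \<in> H2ab \<alpha> \<beta>" for h
    unfolding hinner_diff_left hinner_add_left hinner_hscale_left ker[OF that] by simp
  have "Sab \<alpha> \<beta> f = ?g"
    unfolding Sab_def orth_proj_def
  proof (rule the_equality)
    fix g' assume g': "g' \<in> H2ab \<alpha> \<beta> \<and> (\<forall>h\<in>H2ab \<alpha> \<beta>. hinner (mult_z f - g') h = 0)"
    have "g' - ?g \<in> H2ab \<alpha> \<beta>"
      using g g' assms(1) by (simp add: H2ab_eq hcoeff_diff algebra_simps)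
    \<comment> \<open>Two points of the subspace whose errors are both orthogonal to it differ by a vector that
      is orthogonal to itself.\<close>
    hence "hinner (mult_z f - ?g) (g' - ?g) - hinner (mult_z f - g') (g' - ?g) = 0"
      using orth g' by simp
    hence "hinner (g' - ?g) (g' - ?g) = 0"
      unfolding hinner_diff_left by algebra
    thus "g' = ?g"
      by (simp add: hinner_self_norm)
  qed (use g orth in blast)
  with g show "Sab \<alpha> \<beta> f = ?g" "Sab \<alpha> \<beta> f \<in> H2ab \<alpha> \<beta>" by simp_all
qed

lemma Sab_hscale:
  assumes "\<alpha> \<noteq> 0" "(cmod \<alpha>)\<^sup>2 + (cmod \<beta>)\<^sup>2 = 1"
  shows "Sab \<alpha> \<beta> (hscale c f) = hscale c (Sab \<alpha> \<beta> f)"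
  by (rule hardy2_eqI)
     (simp add: Sab_formula(1)[OF assms] hcoeff_add hcoeff_hscale hcoeff_mult_z distrib_left mult_ac)

text \<open>
  The norm lost under compression is that of the discarded component, \<open>|\<alpha> f(0)|\<close>, because
  multiplication by \<open>z\<close> is isometric. The defining equation of the space and
  \<open>|\<alpha>|\<^sup>2 + |\<beta>|\<^sup>2 = 1\<close> turn \<open>f(0)\<close> into \<open>\<alpha> \<langle>f, e\<rangle>\<close>; in this form the defect
  is a multiple of the squared component of \<open>f\<close> along the unit vector \<open>e = \<alpha> + \<beta> z\<close>.
\<close>

lemma Sab_defect:
  assumes "\<alpha> \<noteq> 0" "(cmod \<alpha>)\<^sup>2 + (cmod \<beta>)\<^sup>2 = 1" "f \<in> H2ab \<alpha> \<beta>"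
  shows "(norm f)\<^sup>2 - (norm (Sab \<alpha> \<beta> f))\<^sup>2 = (cmod \<alpha>) ^ 4 * (cmod (hinner f (lin_poly \<alpha> \<beta>)))\<^sup>2"
proof -
  let ?k = "lin_poly (cnj \<beta>) (- cnj \<alpha>)"
  have "hinner ?k ?k = 1"
    using assms(2) by (intro hinner_lin_poly_self) (simp add: add.commute)
  moreover have zk: "hinner (mult_z f) ?k = - \<alpha> * hcoeff f 0"
    by (simp add: hinner_lin_poly hcoeff_mult_z)
  moreover have "Sab \<alpha> \<beta> f = mult_z f - hscale (hinner (mult_z f) ?k) ?k"
    unfolding zk Sab_formula(1)[OF assms(1,2)]
    by (rule hardy2_eqI) (simp add: hcoeff_add hcoeff_diff hcoeff_hscale)
  moreover have "norm (mult_z f) = norm f"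
    by (simp add: norm_hardy2_def hinner_mult_z)
  ultimately have "(norm (Sab \<alpha> \<beta> f))\<^sup>2 = (norm f)\<^sup>2 - (cmod (\<alpha> * hcoeff f 0))\<^sup>2"
    using norm_power2_minus_component[of ?k "mult_z f"] by simp
  moreover have "hcoeff f 0 = \<alpha> * hinner f (lin_poly \<alpha> \<beta>)"
  proof -
    have "\<alpha> * hinner f (lin_poly \<alpha> \<beta>) = (\<alpha> * cnj \<alpha> + \<beta> * cnj \<beta>) * hcoeff f 0"
      using assms(1,3) by (simp add: H2ab_eq hinner_lin_poly algebra_simps)
    moreover have "\<alpha> * cnj \<alpha> + \<beta> * cnj \<beta> = 1"
      using assms(2) by (metis complex_norm_square of_real_add of_real_1)
    ultimately show ?thesis by simp
  qed
  ultimately show ?thesis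
    by (simp add: norm_mult power_mult_distrib flip: power_mult mult.assoc)
qed

lemma hinner_Sab_lin_poly:
  assumes "\<alpha> \<noteq> 0" "(cmod \<alpha>)\<^sup>2 + (cmod \<beta>)\<^sup>2 = 1"
  shows "hinner (Sab \<alpha> \<beta> (lin_poly \<alpha> \<beta>)) (lin_poly \<alpha> \<beta>) = \<alpha> * cnj \<beta>"
proof -
  have "hinner (lin_poly (cnj \<beta>) (- cnj \<alpha>)) (lin_poly \<alpha> \<beta>) = 0"
    by (simp add: hinner_lin_poly hcoeff_lin_poly)
  thus ?thesis
    unfolding Sab_formula(1)[OF assms] hinner_add_left[of "mult_z _"]
      hinner_hscale_left[of _ "lin_poly (cnj \<beta>) (- cnj \<alpha>)"]
    by (simp add: hinner_lin_poly hcoeff_mult_z hcoeff_lin_poly)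
qed

section \<open>Unitary equivalence\<close>

text \<open>
  Comparing defects of \<open>f\<close> and \<open>U f\<close> gives \<open>|\<alpha>|\<^sup>4 |\<langle>f, e\<rangle>|\<^sup>2 = |\<alpha>\<^sub>1|\<^sup>4 |\<langle>U f, e\<^sub>1\<rangle>|\<^sup>2\<close>. Taking for \<open>f\<close>
  first \<open>e\<close> and then the preimage of \<open>e\<^sub>1\<close> under \<open>U\<close>, Bessel's inequality bounds each of \<open>|\<alpha>|\<close> and \<open>|\<alpha>\<^sub>1|\<close> by the other. Equality in
  Bessel then forces \<open>U e\<close> to be a unimodular multiple of \<open>e\<^sub>1\<close>, and the number \<open>\<langle>S e, e\<rangle>\<close> does not
  notice the unimodular factor.
\<close>

lemma unitary_equivalence_preserves_parameters:
  assumes nz: "\<alpha> \<noteq> 0" "\<alpha>\<^sub>1 \<noteq> 0"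
    and unit: "(cmod \<alpha>)\<^sup>2 + (cmod \<beta>)\<^sup>2 = 1" "(cmod \<alpha>\<^sub>1)\<^sup>2 + (cmod \<beta>\<^sub>1)\<^sup>2 = 1"
    and equiv: "unitarily_equivalent_on (H2ab \<alpha> \<beta>) (Sab \<alpha> \<beta>) (H2ab \<alpha>\<^sub>1 \<beta>\<^sub>1) (Sab \<alpha>\<^sub>1 \<beta>\<^sub>1)"
  shows "cmod \<alpha> = cmod \<alpha>\<^sub>1" "\<alpha> * cnj \<beta> = \<alpha>\<^sub>1 * cnj \<beta>\<^sub>1"
proof -
  let ?M = "H2ab \<alpha> \<beta>" and ?S = "Sab \<alpha> \<beta>" and ?e = "lin_poly \<alpha> \<beta>"
  let ?N = "H2ab \<alpha>\<^sub>1 \<beta>\<^sub>1" and ?T = "Sab \<alpha>\<^sub>1 \<beta>\<^sub>1" and ?e1 = "lin_poly \<alpha>\<^sub>1 \<beta>\<^sub>1"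
  obtain U where bij: "bij_betw U ?M ?N"
    and isom: "\<And>f g. f \<in> ?M \<Longrightarrow> g \<in> ?M \<Longrightarrow> hinner (U f) (U g) = hinner f g"
    and US: "\<And>f. f \<in> ?M \<Longrightarrow> U (?S f) = ?T (U f)"
    using equiv unfolding unitarily_equivalent_on_def unitary_between_def by blast
  note e = lin_poly_in_H2ab[OF nz(1), of \<beta>] and e1 = lin_poly_in_H2ab[OF nz(2), of \<beta>\<^sub>1]
  note ee = hinner_lin_poly_self[OF unit(1)] and ee1 = hinner_lin_poly_self[OF unit(2)]
  have norm_U: "norm (U f) = norm f" if "f \<in> ?M" for f
    using isom[OF that that] by (simp add: norm_hardy2_def)
  have defect: "cmod \<alpha> ^ 4 * (cmod (hinner f ?e))\<^sup>2 = cmod \<alpha>\<^sub>1 ^ 4 * (cmod (hinner (U f) ?e1))\<^sup>2"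
    if f: "f \<in> ?M" for f
    using Sab_defect[OF nz(1) unit(1) f] Sab_defect[OF nz(2) unit(2) bij_betwE[OF bij, rule_format, OF f]]
      norm_U[OF f] norm_U[OF Sab_formula(2)[OF nz(1) unit(1), of f]] US[OF f]
    by simp
  note bound = bessel_unit_vector[OF ee] bessel_unit_vector[OF ee1]
  have norm_e: "norm ?e = 1" and norm_e1: "norm ?e1 = 1"
    using ee ee1 by (simp_all add: norm_hardy2_def)
  obtain h where h: "h \<in> ?M" "U h = ?e1"
    using bij e1 by (metis bij_betw_imp_surj_on imageE)
  let ?c = "hinner (U ?e) ?e1"
  have c: "cmod \<alpha> ^ 4 = cmod \<alpha>\<^sub>1 ^ 4 * (cmod ?c)\<^sup>2"
    using defect[OF e] unfolding ee by simp
  have "(cmod ?c)\<^sup>2 \<le> 1"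
    using bound(2)[of "U ?e"] unfolding norm_U[OF e] norm_e by (simp add: power_le_one)
  hence "cmod \<alpha> ^ 4 \<le> cmod \<alpha>\<^sub>1 ^ 4"
    unfolding c by (simp add: mult_left_le)
  moreover have "cmod \<alpha>\<^sub>1 ^ 4 \<le> cmod \<alpha> ^ 4"
  proof -
    have "cmod \<alpha>\<^sub>1 ^ 4 = cmod \<alpha> ^ 4 * (cmod (hinner h ?e))\<^sup>2"
      using defect[OF h(1)] unfolding h(2) ee1 by simp
    moreover have "(cmod (hinner h ?e))\<^sup>2 \<le> 1"
      using bound(1)[of h] unfolding norm_U[OF h(1), symmetric] h(2) norm_e1 by (simp add: power_le_one)
    ultimately show ?thesis by (simp add: mult_left_le)
  qed
  ultimately have eq4: "cmod \<alpha> ^ 4 = cmod \<alpha>\<^sub>1 ^ 4" by simp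
  thus "cmod \<alpha> = cmod \<alpha>\<^sub>1"
    by (rule power_eq_imp_eq_base) auto
  have c1: "(cmod ?c)\<^sup>2 = 1"
    using c nz(2) unfolding eq4 by simp
  have "(norm (U ?e - hscale ?c ?e1))\<^sup>2 = 0"
    unfolding norm_power2_minus_component[OF ee1] norm_U[OF e] norm_e c1 by simp
  moreover have "?c * cnj ?c = 1"
    unfolding complex_norm_square[symmetric] c1 by simp
  ultimately obtain c where Ue: "U ?e = hscale c ?e1" and cc: "c * cnj c = 1"
    by simp
  have "\<alpha> * cnj \<beta> = hinner (?S ?e) ?e"
    using hinner_Sab_lin_poly[OF nz(1) unit(1)] by simp
  also have "\<dots> = hinner (?T (U ?e)) (U ?e)"
    unfolding US[OF e, symmetric] using isom[OF Sab_formula(2)[OF nz(1) unit(1)] e] by simp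
  also have "\<dots> = c * cnj c * hinner (?T ?e1) ?e1"
    by (simp add: Ue Sab_hscale[OF nz(2) unit(2)] hinner_hscale_left hinner_hscale_right)
  finally show "\<alpha> * cnj \<beta> = \<alpha>\<^sub>1 * cnj \<beta>\<^sub>1"
    using hinner_Sab_lin_poly[OF nz(2) unit(2)] cc by simp
qed

lemma H2ab_scale: "\<alpha> \<noteq> 0 \<Longrightarrow> w \<noteq> 0 \<Longrightarrow> H2ab (w * \<alpha>) (w * \<beta>) = H2ab \<alpha> \<beta>"
  by (simp add: H2ab_eq)

lemma unitarily_equivalent_on_refl: "unitarily_equivalent_on M S M S"
  unfolding unitarily_equivalent_on_def unitary_between_def
  by (rule exI[of _ "\<lambda>f. f"]) (simp add: bij_betw_def)

theorem proposition2p2: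
  fixes \<alpha> \<beta> \<alpha>\<^sub>1 \<beta>\<^sub>1 :: complex
  assumes "\<alpha> \<noteq> 0" "\<beta> \<noteq> 0" "\<alpha>\<^sub>1 \<noteq> 0" "\<beta>\<^sub>1 \<noteq> 0"
    and "(cmod \<alpha>)\<^sup>2 + (cmod \<beta>)\<^sup>2 = 1"
    and "(cmod \<alpha>\<^sub>1)\<^sup>2 + (cmod \<beta>\<^sub>1)\<^sup>2 = 1"
    and "(\<alpha>, \<beta>) \<noteq> (\<alpha>\<^sub>1, \<beta>\<^sub>1)"
  shows "unitarily_equivalent_on (H2ab \<alpha> \<beta>) (Sab \<alpha> \<beta>) (H2ab \<alpha>\<^sub>1 \<beta>\<^sub>1) (Sab \<alpha>\<^sub>1 \<beta>\<^sub>1) \<longleftrightarrow>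
         cmod \<alpha> = cmod \<alpha>\<^sub>1 \<and> cmod \<beta> = cmod \<beta>\<^sub>1 \<and> \<alpha> / \<alpha>\<^sub>1 = cnj \<beta>\<^sub>1 / cnj \<beta>"
proof
  assume equiv: "unitarily_equivalent_on (H2ab \<alpha> \<beta>) (Sab \<alpha> \<beta>) (H2ab \<alpha>\<^sub>1 \<beta>\<^sub>1) (Sab \<alpha>\<^sub>1 \<beta>\<^sub>1)"
  note par = unitary_equivalence_preserves_parameters[OF assms(1,3,5,6) equiv]
  have "(cmod \<beta>)\<^sup>2 = (cmod \<beta>\<^sub>1)\<^sup>2"
    using assms(5,6) unfolding par(1) by linarith
  hence "cmod \<beta> = cmod \<beta>\<^sub>1"
    by (rule power2_eq_imp_eq) simp_all
  with par assms(2,3) show "cmod \<alpha> = cmod \<alpha>\<^sub>1 \<and> cmod \<beta> = cmod \<beta>\<^sub>1 \<and> \<alpha> / \<alpha>\<^sub>1 = cnj \<beta>\<^sub>1 / cnj \<beta>"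
    by (simp add: frac_eq_eq mult.commute)
next
  assume par: "cmod \<alpha> = cmod \<alpha>\<^sub>1 \<and> cmod \<beta> = cmod \<beta>\<^sub>1 \<and> \<alpha> / \<alpha>\<^sub>1 = cnj \<beta>\<^sub>1 / cnj \<beta>"
  \<comment> \<open>The candidate for the unimodular factor between the two parameter pairs.\<close>
  define w where "w = \<beta>\<^sub>1 / \<beta>"
  have "\<beta> * cnj \<beta> = \<beta>\<^sub>1 * cnj \<beta>\<^sub>1"
    using par by (metis complex_norm_square)
  moreover have "\<alpha> * cnj \<beta> = \<alpha>\<^sub>1 * cnj \<beta>\<^sub>1"
    using par assms(2,3) by (simp add: frac_eq_eq mult.commute)
  ultimately have "(\<alpha>\<^sub>1 * cnj \<beta>\<^sub>1) * (\<beta> * cnj \<beta>) = (\<alpha> * cnj \<beta>) * (\<beta>\<^sub>1 * cnj \<beta>\<^sub>1)"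
    by simp
  hence "(\<alpha>\<^sub>1 * \<beta>) * (cnj \<beta> * cnj \<beta>\<^sub>1) = (\<alpha> * \<beta>\<^sub>1) * (cnj \<beta> * cnj \<beta>\<^sub>1)"
    by (simp only: mult_ac)
  hence "\<alpha>\<^sub>1 * \<beta> = \<alpha> * \<beta>\<^sub>1"
    using assms(2,4) by simp
  hence "\<alpha>\<^sub>1 = w * \<alpha>" "\<beta>\<^sub>1 = w * \<beta>" "w \<noteq> 0"
    using assms by (simp_all add: w_def field_simps)
  hence "H2ab \<alpha>\<^sub>1 \<beta>\<^sub>1 = H2ab \<alpha> \<beta>"
    using H2ab_scale assms(1) by simp
  moreover from this have "Sab \<alpha>\<^sub>1 \<beta>\<^sub>1 = Sab \<alpha> \<beta>"
    by (simp add: Sab_def fun_eq_iff)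
  ultimately show "unitarily_equivalent_on (H2ab \<alpha> \<beta>) (Sab \<alpha> \<beta>) (H2ab \<alpha>\<^sub>1 \<beta>\<^sub>1) (Sab \<alpha>\<^sub>1 \<beta>\<^sub>1)"
    by (simp add: unitarily_equivalent_on_refl)
qed

end
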